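(* Let $\{u_i\}_{i=1}^{2d-1}\subseteq\mathbb{C}^d$ be part of an unextendible product basis on $\mathbb{C}^d\otimes\mathbb{C}^d$ of minimal size $2d-1$; that is, there exist $\{v_i\}_{i=1}^{2d-1}\subseteq\mathbb{C}^d$ such that $\{u_i\}_{i=1}^{2d-1}$ and $\{v_i\}_{i=1}^{2d-1}$ form an unextendible product basis. Then the Gram matrix $(\langle u_i,u_j\rangle)_{i,j=1}^{2d-1}$ cannot be completely positive semidefinite (CPSD).
   Context: Unextendible product basis (UPB): two sets of (nonzero) vectors $\{u_i\}_{i=1}^n\subseteq\mathbb{C}^{d_1}$, $\{v_i\}_{i=1}^n\subseteq\mathbb{C}^{d_2}$ form a UPB if the tensor products $u_i\otimes v_i$, $i=1,\dots,n$, are mutually orthogonal and there is no (nonzero) product vector $x\otimes y\in\mathbb{C}^{d_1}\otimes\mathbb{C}^{d_2}$ in the orthogonal complement of $\{u_i\otimes v_i\}_{i=1}^n$. The minimal size of a UPB on $\mathbb{C}^d\otimes\mathbb{C}^d$ is taken to be $n=2d-1$. A symmetric $N\times N$ matrix $X$ is completely positive semidefinite (CPSD) if there exist positive semidefinite matrices $P_1,\dots,P_N\in M_k(\mathbb{C})$, for some $k\ge1$, such that $X_{ij}=\mathrm{Tr}(P_iP_j)$ for all $i,j$.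
   Formalization: The formal theorem assumes d ≥ 2; for d = 1 the claim is false as stated, since a single nonzero vector u_1 with v_1 = u_1 is an unextendible product basis of size 1 under the given definition and its 1×1 Gram matrix is CPSD. *)

theory Defs
  imports "Jordan_Normal_Form.Schur_Decomposition"
begin

text \<open>
  Families indexed by 1, ..., n are rendered as functions on nat of which only the values at
  indices i < n matter. The inner product on complex vectors is the library's
  \<open>x \<bullet>c y = (\<Sum>l. x l * conjugate (y l))\<close>, conjugate-linear in the second argument.
\<close>

text \<open>
  The Kronecker identification of \<open>\<complex>^d\<^sub>1 \<otimes> \<complex>^d\<^sub>2\<close> with \<open>\<complex>^(d\<^sub>1 d\<^sub>2)\<close>: the basis vector
  \<open>e\<^sub>a \<otimes> e\<^sub>b\<close> (counting from 0) is sent to the basis vector with index \<open>a * d\<^sub>2 + b\<close>.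
\<close>
definition tensor_vec :: "complex vec \<Rightarrow> complex vec \<Rightarrow> complex vec" where
  "tensor_vec x y =
     vec (dim_vec x * dim_vec y) (\<lambda>l. x $ (l div dim_vec y) * y $ (l mod dim_vec y))"

text \<open>
  There is no incompleteness requirement \<open>n < d\<^sub>1 * d\<^sub>2\<close>, so complete orthogonal product bases
  are included.
\<close>
definition unextendible_product_basis ::
  "nat \<Rightarrow> nat \<Rightarrow> nat \<Rightarrow> (nat \<Rightarrow> complex vec) \<Rightarrow> (nat \<Rightarrow> complex vec) \<Rightarrow> bool" where
  "unextendible_product_basis d\<^sub>1 d\<^sub>2 n u v \<longleftrightarrow>
     (\<forall>i<n. u i \<in> carrier_vec d\<^sub>1 \<and> u i \<noteq> 0\<^sub>v d\<^sub>1) \<and>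
     (\<forall>i<n. v i \<in> carrier_vec d\<^sub>2 \<and> v i \<noteq> 0\<^sub>v d\<^sub>2) \<and>
     (\<forall>i<n. \<forall>j<n. i \<noteq> j \<longrightarrow> tensor_vec (u i) (v i) \<bullet>c tensor_vec (u j) (v j) = 0) \<and>
     \<not> (\<exists>x\<in>carrier_vec d\<^sub>1. \<exists>y\<in>carrier_vec d\<^sub>2. tensor_vec x y \<noteq> 0\<^sub>v (d\<^sub>1 * d\<^sub>2) \<and>
          (\<forall>i<n. tensor_vec x y \<bullet>c tensor_vec (u i) (v i) = 0))"

definition gram_matrix :: "nat \<Rightarrow> (nat \<Rightarrow> complex vec) \<Rightarrow> complex mat" where
  "gram_matrix n u = mat n n (\<lambda>(i, j). u i \<bullet>c u j)"

definition mat_trace :: "complex mat \<Rightarrow> complex" where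
  "mat_trace A = (\<Sum>i<dim_row A. A $$ (i, i))"

definition psd_mat :: "nat \<Rightarrow> complex mat \<Rightarrow> bool" where
  "psd_mat k A \<longleftrightarrow> A \<in> carrier_mat k k \<and> mat_adjoint A = A \<and>
     (\<forall>x\<in>carrier_vec k. 0 \<le> Re ((A *\<^sub>v x) \<bullet>c x))"

text \<open>
  The entries are complex so that the definition applies to Gram matrices of complex vectors;
  the trace condition forces them to be real, because the trace of a product of two Hermitian
  matrices is real.
\<close>
definition completely_psd :: "nat \<Rightarrow> complex mat \<Rightarrow> bool" where
  "completely_psd N X \<longleftrightarrow> X \<in> carrier_mat N N \<and> transpose_mat X = X \<and>
     (\<exists>k\<ge>1. \<exists>P. (\<forall>i<N. psd_mat k (P i)) \<and>
        (\<forall>i<N. \<forall>j<N. X $$ (i, j) = mat_trace (P i * P j)))"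

end

theory Submission
  imports Defs
begin

text \<open>
  Minimality forces any \<open>d\<close> of the \<open>u\<^sub>i\<close> (and of the \<open>v\<^sub>i\<close>) to span: a vector orthogonal to \<open>d\<close> of the
  \<open>u\<^sub>i\<close>, tensored with one orthogonal to the other \<open>d - 1\<close> of the \<open>v\<^sub>i\<close>, would extend the basis.
  So \<open>u\<^sub>i\<close> is orthogonal to exactly \<open>d - 1\<close> of the \<open>u\<^sub>j\<close>, and together they span.

  If \<open>Tr (P\<^sub>i P\<^sub>j) = \<langle>u\<^sub>i, u\<^sub>j\<rangle>\<close>, the \<open>P\<^sub>i\<close> obey the same linear relations as the \<open>u\<^sub>i\<close>, and \<open>P\<^sub>i P\<^sub>j = 0\<close>
  whenever \<open>u\<^sub>i\<close> and \<open>u\<^sub>j\<close> are orthogonal. For \<open>u\<^sub>m\<close> not orthogonal to \<open>u\<^sub>i\<close>, expanding \<open>P\<^sub>m\<close> in \<open>P\<^sub>i\<close> and the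
  \<open>P\<^sub>j\<close> with \<open>u\<^sub>j\<close> orthogonal to \<open>u\<^sub>i\<close> gives \<open>P\<^sub>m P\<^sub>i = P\<^sub>i P\<^sub>m = a P\<^sub>i\<^sup>2\<close>, and by symmetry it equals \<open>b P\<^sub>m\<^sup>2\<close>
  with \<open>b \<noteq> 0\<close>. Then \<open>X = P\<^sub>m - a P\<^sub>i\<close> satisfies \<open>X P\<^sub>i = 0\<close>, hence \<open>X P\<^sub>m\<^sup>2 = 0\<close>, \<open>X P\<^sub>m = 0\<close> and \<open>X = 0\<close>.
  So \<open>u\<^sub>m = a u\<^sub>i\<close>, which contradicts the spanning property.
\<close>

section \<open>Orthogonality in coordinate space\<close>

lemma cscalar_prod_eq_sum:
  fixes x y :: "complex vec"
  assumes "x \<in> carrier_vec n" "y \<in> carrier_vec n"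
  shows "x \<bullet>c y = (\<Sum>l<n. x $ l * cnj (y $ l))"
  using assms by (auto simp: scalar_prod_def atLeast0LessThan intro!: sum.cong)

lemma cscalar_prod_commute_cnj:
  fixes x y :: "complex vec"
  assumes "x \<in> carrier_vec n" "y \<in> carrier_vec n"
  shows "y \<bullet>c x = cnj (x \<bullet>c y)"
  using assms by (simp add: cscalar_prod_eq_sum[of _ n] mult.commute)

text \<open>Fewer than \<open>n\<close> linear conditions on \<open>n\<close> coordinates: padded
  with zero rows they form a singular square matrix, whose kernel supplies \<open>x\<close>.\<close>

lemma ex_common_orthogonal:
  fixes w :: "nat \<Rightarrow> complex vec"
  assumes "finite S" "card S < n" and w: "\<And>i. i \<in> S \<Longrightarrow> w i \<in> carrier_vec n"
  obtains x where "x \<in> carrier_vec n" "x \<noteq> 0\<^sub>v n" "\<And>i. i \<in> S \<Longrightarrow> x \<bullet>c w i = 0"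
proof -
  obtain f where f: "bij_betw f {0..<card S} S"
    using ex_bij_betw_nat_finite[OF assms(1)] by blast
  define A where "A = mat n n (\<lambda>(i, l). if i < card S then cnj (w (f i) $ l) else 0)"
  have A: "A \<in> carrier_mat n n" by (simp add: A_def)
  \<comment> \<open>Row \<open>card S\<close> of \<open>A\<close> is a padding row, so the transpose
    kills the corresponding unit vector.\<close>
  have "transpose_mat A *\<^sub>v unit_vec n (card S) = 0\<^sub>v n"
    using assms(2) by (intro eq_vecI) (auto simp: A_def)
  moreover have "(unit_vec n (card S) :: complex vec) \<noteq> 0\<^sub>v n"
    using assms(2) by simp
  ultimately have "det (transpose_mat A) = 0"
    using det_0_iff_vec_prod_zero[of "transpose_mat A" n] A
    by (metis transpose_carrier_mat unit_vec_carrier)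
  then have "det A = 0"
    using det_transpose[OF A] by simp
  then obtain x where x: "x \<in> carrier_vec n" "x \<noteq> 0\<^sub>v n" "A *\<^sub>v x = 0\<^sub>v n"
    using det_0_iff_vec_prod_zero[OF A] by blast
  have "x \<bullet>c w i = 0" if "i \<in> S" for i
  proof -
    have "i \<in> f ` {0..<card S}"
      using that bij_betw_imp_surj_on[OF f] by simp
    then obtain j where j: "j < card S" "f j = i" by auto
    with assms(2) have "j < n" by simp
    then have "(A *\<^sub>v x) $ j = (\<Sum>l<n. x $ l * cnj (w i $ l))"
      using x(1) j
      by (simp add: A_def scalar_prod_def atLeast0LessThan mult.commute)
    also have "\<dots> = x \<bullet>c w i"
      using cscalar_prod_eq_sum[OF x(1) w[OF that]] by simp
    finally show ?thesis using x(3) j assms(2) by simp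
  qed
  then show thesis using that x by blast
qed

text \<open>The matrix with columns \<open>w i\<close> is invertible, since a kernel vector of its
  transpose would yield a nonzero vector orthogonal to all of them; the inverse turns
  \<open>z\<close> into coefficients.\<close>

lemma ex_linear_combination:
  fixes w :: "nat \<Rightarrow> complex vec"
  assumes "finite S" "card S = n" and w: "\<And>i. i \<in> S \<Longrightarrow> w i \<in> carrier_vec n"
    and perp: "\<And>x. x \<in> carrier_vec n \<Longrightarrow> (\<And>i. i \<in> S \<Longrightarrow> x \<bullet>c w i = 0) \<Longrightarrow> x = 0\<^sub>v n"
    and z: "z \<in> carrier_vec n"
  obtains a where "\<And>l. l < n \<Longrightarrow> z $ l = (\<Sum>i\<in>S. a i * w i $ l)"
proof -
  obtain f where f: "bij_betw f {0..<n} S"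
    using ex_bij_betw_nat_finite[OF assms(1)] assms(2) by blast
  have fS: "f i \<in> S" if "i < n" for i
    using f that by (fastforce simp: bij_betw_def)
  define A where "A = mat n n (\<lambda>(l, i). w (f i) $ l)"
  have A: "A \<in> carrier_mat n n" by (simp add: A_def)
  have "det (transpose_mat A) \<noteq> 0"
  proof
    assume "det (transpose_mat A) = 0"
    then obtain x where x: "x \<in> carrier_vec n" "x \<noteq> 0\<^sub>v n" "transpose_mat A *\<^sub>v x = 0\<^sub>v n"
      using det_0_iff_vec_prod_zero[of "transpose_mat A" n] A by auto
    \<comment> \<open>The transpose pairs \<open>x\<close> with \<open>w i\<close> without
      conjugation, whereas \<open>\<bullet>c\<close> conjugates \<open>w i\<close>; hence the
      conjugate of \<open>x\<close>.\<close>
    have "conjugate x \<bullet>c w i = 0" if "i \<in> S" for i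
    proof -
      have "i \<in> f ` {0..<n}"
        using that bij_betw_imp_surj_on[OF f] by simp
      then obtain j where j: "j < n" "f j = i" by auto
      then have "(transpose_mat A *\<^sub>v x) $ j = (\<Sum>l<n. w i $ l * x $ l)"
        using x(1) by (simp add: A_def scalar_prod_def atLeast0LessThan)
      moreover have "conjugate x \<bullet>c w i = cnj (\<Sum>l<n. w i $ l * x $ l)"
        using cscalar_prod_eq_sum[of "conjugate x" n "w i"] x(1) w[OF that]
        by (simp add: mult.commute)
      ultimately show ?thesis using x(3) j by simp
    qed
    then have "conjugate x = 0\<^sub>v n"
      using x(1) by (intro perp carrier_vec_conjugate)
    then have "conjugate (conjugate x) = 0\<^sub>v n" by simp
    then show False using x(2) by simp
  qed
  then have "det A \<noteq> 0" using det_transpose[OF A] by simp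
  from det_non_zero_imp_unit[OF A this, of "()"]
  obtain B where B: "B \<in> carrier_mat n n" "A * B = 1\<^sub>m n"
    unfolding Units_def ring_mat_def by auto
  define b where "b = B *\<^sub>v z"
  have b: "b \<in> carrier_vec n" using B z by (simp add: b_def)
  have Ab: "A *\<^sub>v b = z" using A B z assoc_mult_mat_vec[OF A B(1) z] by (simp add: b_def)
  have "z $ l = (\<Sum>i\<in>S. b $ (inv_into {0..<n} f i) * w i $ l)" if "l < n" for l
  proof -
    have "z $ l = (\<Sum>i<n. b $ i * w (f i) $ l)"
      unfolding Ab[symmetric] using that b
      by (auto simp: A_def scalar_prod_def atLeast0LessThan mult.commute intro!: sum.cong)
    also have "\<dots> = (\<Sum>i\<in>S. b $ (inv_into {0..<n} f i) * w i $ l)"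
    proof -
      have inj: "inj_on f {0..<n}" using f by (simp add: bij_betw_def)
      show ?thesis
        unfolding sum.reindex_bij_betw[OF f, symmetric]
        by (auto simp: inv_into_f_f[OF inj] atLeast0LessThan[symmetric] intro!: sum.cong)
    qed
    finally show ?thesis .
  qed
  then show thesis by (rule that)
qed

section \<open>Unextendible product bases\<close>

lemma cscalar_prod_tensor_vec:
  assumes x: "x \<in> carrier_vec m" and x': "x' \<in> carrier_vec m"
    and y: "y \<in> carrier_vec n" and y': "y' \<in> carrier_vec n"
  shows "tensor_vec x y \<bullet>c tensor_vec x' y' = (x \<bullet>c x') * (y \<bullet>c y')"
proof -
  let ?f = "\<lambda>l. x $ (l div n) * y $ (l mod n) * cnj (x' $ (l div n) * y' $ (l mod n))"
  have "tensor_vec x y \<bullet>c tensor_vec x' y' = (\<Sum>l<m * n. ?f l)"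
    using assms by (subst cscalar_prod_eq_sum[of _ "m * n"]) (auto simp: tensor_vec_def)
  \<comment> \<open>Cut the index range into \<open>m\<close> blocks of length \<open>n\<close>:
    block \<open>a\<close> holds the indices \<open>a * n + b\<close>, from which div and mod
    recover \<open>a\<close> and \<open>b\<close>.\<close>
  also have "\<dots> = (\<Sum>a<m. sum ?f {a * n..<a * n + n})"
    by (rule sum.nat_group[symmetric])
  also have "\<dots> = (\<Sum>a<m. \<Sum>b<n. (x $ a * cnj (x' $ a)) * (y $ b * cnj (y' $ b)))"
  proof (rule sum.cong[OF refl])
    fix a
    have "sum ?f {a * n..<a * n + n} = (\<Sum>b<n. ?f (b + a * n))"
      using sum.shift_bounds_nat_ivl[of ?f 0 "a * n" n]
      by (simp add: atLeast0LessThan add.commute)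
    also have "\<dots> = (\<Sum>b<n. (x $ a * cnj (x' $ a)) * (y $ b * cnj (y' $ b)))"
      by (intro sum.cong) auto
    finally show "sum ?f {a * n..<a * n + n} = \<dots>" .
  qed
  also have "\<dots> = (x \<bullet>c x') * (y \<bullet>c y')"
    using assms by (simp add: cscalar_prod_eq_sum[of _ m] cscalar_prod_eq_sum[of _ n]
        sum_distrib_left sum_distrib_right sum.swap[of _ "{..<n}"])
  finally show ?thesis .
qed

lemma cscalar_prod_self_eq_0:
  fixes x :: "complex vec"
  assumes "x \<in> carrier_vec n"
  shows "x \<bullet>c x = 0 \<longleftrightarrow> x = 0\<^sub>v n"
  using conjugate_square_eq_0_vec[OF assms] by simp

lemma upb_carrier:
  assumes "unextendible_product_basis d\<^sub>1 d\<^sub>2 n u v" "i < n"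
  shows "u i \<in> carrier_vec d\<^sub>1" "u i \<noteq> 0\<^sub>v d\<^sub>1" "v i \<in> carrier_vec d\<^sub>2" "v i \<noteq> 0\<^sub>v d\<^sub>2"
  using assms by (auto simp: unextendible_product_basis_def)

lemma upb_orthogonal:
  assumes "unextendible_product_basis d\<^sub>1 d\<^sub>2 n u v" "i < n" "j < n" "i \<noteq> j"
  shows "u i \<bullet>c u j = 0 \<or> v i \<bullet>c v j = 0"
proof -
  have "tensor_vec (u i) (v i) \<bullet>c tensor_vec (u j) (v j) = 0"
    using assms by (auto simp: unextendible_product_basis_def)
  then show ?thesis
    using cscalar_prod_tensor_vec upb_carrier assms by (metis mult_eq_0_iff)
qed

text \<open>Inner products of product vectors factor, so unextendibility can be tested on the
  factors; \<open>tensor_vec x y\<close> is nonzero because its squared norm is a product of two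
  nonzero numbers.\<close>

lemma upb_no_orthogonal_product:
  assumes upb: "unextendible_product_basis d\<^sub>1 d\<^sub>2 n u v"
    and x: "x \<in> carrier_vec d\<^sub>1" "x \<noteq> 0\<^sub>v d\<^sub>1" and y: "y \<in> carrier_vec d\<^sub>2" "y \<noteq> 0\<^sub>v d\<^sub>2"
  shows "\<exists>i<n. x \<bullet>c u i \<noteq> 0 \<and> y \<bullet>c v i \<noteq> 0"
proof -
  have "tensor_vec x y \<bullet>c tensor_vec x y \<noteq> 0"
    using cscalar_prod_self_eq_0[OF x(1)] cscalar_prod_self_eq_0[OF y(1)] x(2) y(2)
    unfolding cscalar_prod_tensor_vec[OF x(1) x(1) y(1) y(1)] by simp
  moreover have "tensor_vec x y \<in> carrier_vec (d\<^sub>1 * d\<^sub>2)"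
    using x(1) y(1) by (auto simp: tensor_vec_def)
  ultimately have "tensor_vec x y \<noteq> 0\<^sub>v (d\<^sub>1 * d\<^sub>2)"
    using cscalar_prod_self_eq_0 by blast
  then obtain i where "i < n" "tensor_vec x y \<bullet>c tensor_vec (u i) (v i) \<noteq> 0"
    using upb x y unfolding unextendible_product_basis_def by blast
  then show ?thesis
    using cscalar_prod_tensor_vec[OF x(1) upb_carrier(1)[OF upb] y(1) upb_carrier(3)[OF upb]]
    by auto
qed

text \<open>The bound on \<open>n\<close> leaves fewer than \<open>d\<^sub>2\<close> indices outside
  \<open>S\<close>, so some nonzero \<open>y\<close> is orthogonal to the \<open>v i\<close> there;
  for nonzero \<open>x\<close>, \<open>tensor_vec x y\<close> would then be orthogonal to the whole
  basis.\<close>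

lemma upb_minimal_spanning_left:
  assumes upb: "unextendible_product_basis d\<^sub>1 d\<^sub>2 n u v" and "S \<subseteq> {..<n}" "n < card S + d\<^sub>2"
    and x: "x \<in> carrier_vec d\<^sub>1" "\<And>i. i \<in> S \<Longrightarrow> x \<bullet>c u i = 0"
  shows "x = 0\<^sub>v d\<^sub>1"
proof (rule ccontr)
  assume x0: "x \<noteq> 0\<^sub>v d\<^sub>1"
  have "card ({..<n} - S) < d\<^sub>2"
    using assms(2,3) card_Diff_subset[of S "{..<n}"] finite_subset[OF assms(2)]
      card_mono[OF _ assms(2)] by auto
  then obtain y where y: "y \<in> carrier_vec d\<^sub>2" "y \<noteq> 0\<^sub>v d\<^sub>2" "\<And>i. i \<in> {..<n} - S \<Longrightarrow> y \<bullet>c v i = 0"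
    using ex_common_orthogonal[of "{..<n} - S" d\<^sub>2 v] upb_carrier[OF upb] by auto
  then show False
    using upb_no_orthogonal_product[OF upb x(1) x0 y(1,2)] x(2) by blast
qed

lemma upb_minimal_spanning_right:
  assumes upb: "unextendible_product_basis d\<^sub>1 d\<^sub>2 n u v" and "S \<subseteq> {..<n}" "n < card S + d\<^sub>1"
    and y: "y \<in> carrier_vec d\<^sub>2" "\<And>i. i \<in> S \<Longrightarrow> y \<bullet>c v i = 0"
  shows "y = 0\<^sub>v d\<^sub>2"
proof (rule ccontr)
  assume y0: "y \<noteq> 0\<^sub>v d\<^sub>2"
  have "card ({..<n} - S) < d\<^sub>1"
    using assms(2,3) card_Diff_subset[of S "{..<n}"] finite_subset[OF assms(2)]
      card_mono[OF _ assms(2)] by auto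
  then obtain x where x: "x \<in> carrier_vec d\<^sub>1" "x \<noteq> 0\<^sub>v d\<^sub>1" "\<And>i. i \<in> {..<n} - S \<Longrightarrow> x \<bullet>c u i = 0"
    using ex_common_orthogonal[of "{..<n} - S" d\<^sub>1 u] upb_carrier[OF upb] by auto
  then show False
    using upb_no_orthogonal_product[OF upb x(1,2) y(1) y0] y(2) by blast
qed

text \<open>For \<open>u\<close> and for \<open>v\<close>, the indices orthogonal to
  \<open>i\<close> number at most \<open>d - 1\<close>; together they cover the other
  \<open>2 * d - 2\<close> indices, so both bounds are attained.\<close>

lemma upb_minimal_card_orthogonal:
  assumes upb: "unextendible_product_basis d d (2 * d - 1) u v" and i: "i < 2 * d - 1"
  shows "card {j. j < 2 * d - 1 \<and> u i \<bullet>c u j = 0} = d - 1"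
proof -
  let ?n = "2 * d - 1"
  let ?U = "{j. j < ?n \<and> u i \<bullet>c u j = 0}" and ?V = "{j. j < ?n \<and> v i \<bullet>c v j = 0}"
  \<comment> \<open>\<open>u i\<close> is itself orthogonal to every \<open>u j\<close> in
    \<open>?U\<close>, so a larger \<open>?U\<close> would force \<open>u i\<close> to be
    zero.\<close>
  have "\<not> ?n < card ?U + d"
  proof
    assume "?n < card ?U + d"
    then have "u i = 0\<^sub>v d"
      by (intro upb_minimal_spanning_left[OF upb, of ?U]) (use upb_carrier(1)[OF upb i] in auto)
    then show False using upb_carrier(2)[OF upb i] by simp
  qed
  moreover have "\<not> ?n < card ?V + d"
  proof
    assume "?n < card ?V + d"
    then have "v i = 0\<^sub>v d"
      by (intro upb_minimal_spanning_right[OF upb, of ?V]) (use upb_carrier(3)[OF upb i] in auto)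
    then show False using upb_carrier(4)[OF upb i] by simp
  qed
  moreover have "{..<?n} - {i} \<subseteq> ?U \<union> ?V"
    using upb_orthogonal[OF upb i] by auto
  then have "card ({..<?n} - {i}) \<le> card ?U + card ?V"
    using card_mono[of "?U \<union> ?V" "{..<?n} - {i}"] card_Un_le[of ?U ?V] by simp
  moreover have "card ({..<?n} - {i}) = ?n - 1" using i by simp
  ultimately show ?thesis by linarith
qed

section \<open>Positive semidefinite matrices\<close>

text \<open>The sesquilinear form of \<open>A\<close>, conjugate-linear in \<open>y\<close>. Plain
  functions, read only below \<open>k\<close>, free the elimination argument from carrier
  conditions.\<close>

definition hform :: "nat \<Rightarrow> (nat \<Rightarrow> nat \<Rightarrow> complex) \<Rightarrow> (nat \<Rightarrow> complex) \<Rightarrow> (nat \<Rightarrow> complex) \<Rightarrow> complex"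
  where "hform k A x y = (\<Sum>r<k. \<Sum>s<k. A r s * x s * cnj (y r))"

definition pos_form :: "nat \<Rightarrow> (nat \<Rightarrow> nat \<Rightarrow> complex) \<Rightarrow> bool" where
  "pos_form k A \<longleftrightarrow> (\<forall>r<k. \<forall>s<k. A s r = cnj (A r s)) \<and> (\<forall>x. 0 \<le> Re (hform k A x x))"

lemma pos_form_cnj: "pos_form k A \<Longrightarrow> r < k \<Longrightarrow> s < k \<Longrightarrow> A s r = cnj (A r s)"
  unfolding pos_form_def by blast

lemma pos_form_nonneg: "pos_form k A \<Longrightarrow> 0 \<le> Re (hform k A x x)"
  unfolding pos_form_def by blast

lemma hform_diff_left:
  "hform k A (\<lambda>s. x s - c * e s) y = hform k A x y - c * hform k A e y"
  by (simp add: hform_def algebra_simps sum_subtractf sum_distrib_left)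

lemma hform_diff_right:
  "hform k A y (\<lambda>s. x s - c * e s) = hform k A y x - cnj c * hform k A y e"
  by (simp add: hform_def algebra_simps sum_subtractf sum_distrib_left)

lemma hform_commute_cnj:
  assumes "pos_form k A"
  shows "hform k A y x = cnj (hform k A x y)"
proof -
  have "cnj (hform k A x y) = (\<Sum>r<k. \<Sum>s<k. A s r * y r * cnj (x s))"
    unfolding hform_def cnj_sum
    by (intro sum.cong refl) (simp add: pos_form_cnj[OF assms, symmetric])
  also have "\<dots> = hform k A y x"
    unfolding hform_def by (rule sum.swap)
  finally show ?thesis by simp
qed

lemma hform_unit_right:
  assumes "m < k"
  shows "hform k A x (\<lambda>s. if s = m then 1 else 0) = (\<Sum>s<k. A m s * x s)"
proof -
  have "hform k A x (\<lambda>s. if s = m then 1 else 0) = (\<Sum>r<k. if r = m then \<Sum>s<k. A m s * x s else 0)"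
    unfolding hform_def by (intro sum.cong refl) auto
  then show ?thesis using assms by simp
qed

text \<open>Nonnegativity at \<open>x - t * b * e\<close>, with \<open>b\<close> the mixed value and
  \<open>t\<close> real, gives a quadratic inequality in \<open>t\<close>. The form may be
  degenerate, so \<open>?p\<close> may vanish.\<close>

lemma hform_Cauchy_Schwarz:
  assumes A: "pos_form k A"
  shows "(cmod (hform k A x e))\<^sup>2 \<le> Re (hform k A x x) * Re (hform k A e e)"
proof -
  let ?B = "Re (hform k A x x)" and ?p = "Re (hform k A e e)" and ?s = "(cmod (hform k A x e))\<^sup>2"
  have B: "0 \<le> ?B" and p: "0 \<le> ?p" using pos_form_nonneg[OF A] by auto
  have ineq: "0 \<le> ?B - 2 * t * ?s + t\<^sup>2 * ?s * ?p" for t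
  proof -
    define b where "b = hform k A x e"
    define c where "c = complex_of_real t * b"
    have b: "b * cnj b = complex_of_real ?s"
      unfolding b_def by (rule complex_norm_square[symmetric])
    have "hform k A (\<lambda>s. x s - c * e s) (\<lambda>s. x s - c * e s)
        = hform k A x x - cnj c * b - c * (cnj b - cnj c * hform k A e e)"
      by (simp only: hform_diff_left hform_diff_right b_def hform_commute_cnj[OF A, of e x])
    also have "\<dots> = hform k A x x - 2 * t * (b * cnj b) + t\<^sup>2 * (b * cnj b) * hform k A e e"
      by (simp add: c_def algebra_simps power2_eq_square)
    also have "Re \<dots> = ?B - 2 * t * ?s + t\<^sup>2 * ?s * ?p"
      unfolding b by (simp flip: of_real_power)
    finally have "Re (hform k A (\<lambda>s. x s - c * e s) (\<lambda>s. x s - c * e s))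
      = ?B - 2 * t * ?s + t\<^sup>2 * ?s * ?p" .
    moreover have "0 \<le> Re (hform k A (\<lambda>s. x s - c * e s) (\<lambda>s. x s - c * e s))"
      by (rule pos_form_nonneg[OF A])
    ultimately show ?thesis by linarith
  qed
  \<comment> \<open>If \<open>?p\<close> vanishes, the inequality is affine in \<open>t\<close> and
    the chosen \<open>t\<close> makes its right-hand side -1; if \<open>?p\<close> is positive,
    \<open>1 / ?p\<close> minimises the quadratic.\<close>
  consider "?s = 0" | "?s > 0" "?p = 0" | "?p > 0"
    using p zero_le_power2[of "cmod (hform k A x e)"] by argo
  then show ?thesis
  proof cases
    case 1
    then show ?thesis using B p by simp
  next
    case 2
    with ineq[of "(?B + 1) / (2 * ?s)"] show ?thesis by (simp add: field_simps)
  next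
    case 3
    with ineq[of "1 / ?p"] show ?thesis by (simp add: field_simps power2_eq_square)
  qed
qed

text \<open>Pivoting as in Cholesky's algorithm. When the pivot \<open>A m m\<close> vanishes, so does its row, and
  division by zero makes the correction term vanish too.\<close>

lemma pos_form_rank_one_sum_aux:
  assumes "pos_form k A" "m \<le> k"
    and "\<And>r s. r < k \<Longrightarrow> s < k \<Longrightarrow> m \<le> r \<or> m \<le> s \<Longrightarrow> A r s = 0"
  shows "\<exists>y. \<forall>r<k. \<forall>s<k. A r s = (\<Sum>l<m. y l r * cnj (y l s))"
  using assms
proof (induction m arbitrary: A)
  case 0
  then show ?case by simp
next
  case (Suc m)
  note A = Suc.prems(1)
  have m: "m < k" using Suc.prems by simp
  have herm: "A s r = cnj (A r s)" if "r < k" "s < k" for r s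
    by (rule pos_form_cnj[OF A that])
  let ?e = "\<lambda>j s. if s = j then 1 else 0 :: complex"
  have ee: "hform k A (?e s) (?e r) = A r s" if "r < k" "s < k" for r s
    using that by (simp add: hform_unit_right if_distrib[of "(*) _"] cong: if_cong)
  define p where "p = Re (A m m)"
  have Amm: "A m m = complex_of_real p"
    using herm[OF m m] unfolding p_def by (metis Reals_cnj_iff of_real_Re)
  have p0: "0 \<le> p"
    using pos_form_nonneg[OF A, of "?e m"] unfolding p_def ee[OF m m] .
  \<comment> \<open>Cauchy-Schwarz for two unit vectors bounds the squared modulus of
    \<open>A m s\<close> by a multiple of \<open>p\<close>.\<close>
  have row0: "A m s = 0" if "s < k" "p = 0" for s
    using hform_Cauchy_Schwarz[OF A, of "?e s" "?e m"] that m by (simp add: ee Amm)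
  \<comment> \<open>The Schur complement: elimination with pivot \<open>p\<close> clears row and
    column \<open>m\<close>.\<close>
  define g where "g = (\<lambda>r s. A r s - A r m * A m s / p)"
  have gform: "Re (hform k g x x) = Re (hform k A x x) - (cmod (hform k A x (?e m)))\<^sup>2 / p" for x
  proof -
    let ?b = "\<Sum>s<k. A m s * x s"
    have "hform k g x x = hform k A x x - (\<Sum>r<k. \<Sum>s<k. A r m * A m s / p * x s * cnj (x r))"
      by (simp add: hform_def g_def algebra_simps sum_subtractf)
    also have "(\<Sum>r<k. \<Sum>s<k. A r m * A m s / p * x s * cnj (x r)) = (\<Sum>r<k. A r m * cnj (x r)) * ?b / p"
      unfolding sum_product sum_divide_distrib by (simp add: mult_ac)
    also have "(\<Sum>r<k. A r m * cnj (x r)) = cnj ?b"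
      unfolding cnj_sum using herm[OF m] by (intro sum.cong refl) auto
    also have "cnj ?b * ?b = complex_of_real ((cmod ?b)\<^sup>2)"
      by (simp only: complex_norm_square mult.commute)
    finally show ?thesis
      by (simp add: hform_unit_right[OF m] flip: of_real_power of_real_divide)
  qed
  have g: "pos_form k g"
    unfolding pos_form_def
  proof (intro conjI allI impI)
    fix r s assume "r < k" "s < k"
    then show "g s r = cnj (g r s)"
      using herm[of r s] herm[of r m] herm[of m s] m by (simp add: g_def)
  next
    fix x
    \<comment> \<open>Cauchy-Schwarz against the unit vector \<open>?e m\<close> bounds exactly the
      term subtracted in \<open>gform\<close>.\<close>
    have "(cmod (hform k A x (?e m)))\<^sup>2 \<le> Re (hform k A x x) * p"
      using hform_Cauchy_Schwarz[OF A, of x "?e m"] ee[OF m m] by (simp add: p_def)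
    moreover have "0 \<le> Re (hform k A x x)" by (rule pos_form_nonneg[OF A])
    ultimately show "0 \<le> Re (hform k g x x)"
      unfolding gform using p0 by (cases "p = 0") (auto simp: field_simps)
  qed
  have g0: "g r s = 0" if "r < k" "s < k" "m \<le> r \<or> m \<le> s" for r s
  proof -
    have *: "A m s = 0 \<and> A s m = 0" if "s < k" "p = 0" for s
      using row0[OF that] herm[OF m that(1)] by simp
    show ?thesis
    proof (cases "r = m \<or> s = m")
      case True
      then show ?thesis
      proof (cases "p = 0")
        case True
        with \<open>r = m \<or> s = m\<close> * that show ?thesis unfolding g_def by auto
      next
        case False
        have "A r s - A r m * A m s / A m m = 0"
          using \<open>r = m \<or> s = m\<close> False Amm by auto
        then show ?thesis unfolding g_def Amm .
      qed
    next
      case False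
      with that(3) have rs: "Suc m \<le> r \<or> Suc m \<le> s" by auto
      have "A r s = 0" using Suc.prems(3)[OF that(1,2) rs] .
      moreover have "A r m = 0 \<or> A m s = 0"
        using Suc.prems(3)[OF that(1) m] Suc.prems(3)[OF m that(2)] rs by blast
      ultimately show ?thesis by (auto simp: g_def)
    qed
  qed
  obtain y where y: "\<And>r s. r < k \<Longrightarrow> s < k \<Longrightarrow> g r s = (\<Sum>l<m. y l r * cnj (y l s))"
    using Suc.IH[OF g _ g0] m by auto
  \<comment> \<open>The new vector is column \<open>m\<close> scaled by \<open>sqrt p\<close>, so
    its rank-one term is the correction removed in \<open>g\<close>.\<close>
  define y' where "y' = y(m := \<lambda>r. A r m / sqrt p)"
  have "A r s = (\<Sum>l<Suc m. y' l r * cnj (y' l s))" if "r < k" "s < k" for r s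
  proof -
    have "(\<Sum>l<Suc m. y' l r * cnj (y' l s)) = (\<Sum>l<m. y l r * cnj (y l s)) + y' m r * cnj (y' m s)"
      by (simp add: y'_def)
    also have "y' m r * cnj (y' m s)
        = A r m * A m s / (complex_of_real (sqrt p) * complex_of_real (sqrt p))"
      by (simp only: y'_def herm[OF that(2) m] fun_upd_same complex_cnj_divide
          complex_cnj_complex_of_real times_divide_times_eq)
    also have "complex_of_real (sqrt p) * complex_of_real (sqrt p) = p"
      using p0 by (simp flip: of_real_mult)
    finally have "(\<Sum>l<Suc m. y' l r * cnj (y' l s)) = g r s + A r m * A m s / p"
      unfolding y[OF that] .
    then show ?thesis by (simp only: g_def diff_add_cancel)
  qed
  then show ?case by blast
qed

lemma pos_form_rank_one_sum:
  assumes "pos_form k A"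
  obtains y where "\<And>r s. r < k \<Longrightarrow> s < k \<Longrightarrow> A r s = (\<Sum>l<k. y l r * cnj (y l s))"
  using pos_form_rank_one_sum_aux[OF assms order_refl] by auto

text \<open>With \<open>B\<close> a sum of rank-one terms, the trace is the sum of the nonnegative
  values of the form of \<open>A\<close> at the \<open>y l\<close>. All vanish, so by Cauchy-Schwarz
  \<open>A\<close> kills every \<open>y l\<close> and hence every column of
  \<open>B\<close>.\<close>

lemma pos_form_product_eq_0:
  assumes A: "pos_form k A" and B: "pos_form k B"
    and tr: "(\<Sum>r<k. \<Sum>s<k. A r s * B s r) = 0" and rt: "r < k" "t < k"
  shows "(\<Sum>s<k. A r s * B s t) = 0"
proof -
  obtain y where y: "\<And>r s. r < k \<Longrightarrow> s < k \<Longrightarrow> B r s = (\<Sum>l<k. y l r * cnj (y l s))"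
    using pos_form_rank_one_sum[OF B] by blast
  have "(\<Sum>r<k. \<Sum>s<k. A r s * B s r) = (\<Sum>r<k. \<Sum>s<k. \<Sum>l<k. A r s * y l s * cnj (y l r))"
    by (intro sum.cong refl) (simp add: y sum_distrib_left mult.assoc)
  also have "\<dots> = (\<Sum>r<k. \<Sum>l<k. \<Sum>s<k. A r s * y l s * cnj (y l r))"
    by (intro sum.cong refl sum.swap)
  also have "\<dots> = (\<Sum>l<k. hform k A (y l) (y l))"
    unfolding hform_def by (rule sum.swap)
  finally have "(\<Sum>l<k. Re (hform k A (y l) (y l))) = 0"
    using tr by (metis Re_sum zero_complex.sel(1))
  then have "Re (hform k A (y l) (y l)) = 0" if "l < k" for l
    using that pos_form_nonneg[OF A] by (subst (asm) sum_nonneg_eq_0_iff) auto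
  then have "hform k A (y l) x = 0" if "l < k" for l x
    using hform_Cauchy_Schwarz[OF A, of "y l" x] that by simp
  then have Ay: "(\<Sum>s<k. A r s * y l s) = 0" if "l < k" for l
    using hform_unit_right[OF rt(1), of A "y l"] that by simp
  have "(\<Sum>s<k. A r s * B s t) = (\<Sum>s<k. \<Sum>l<k. A r s * y l s * cnj (y l t))"
    using rt by (intro sum.cong refl) (simp add: y sum_distrib_left mult.assoc)
  also have "\<dots> = (\<Sum>l<k. (\<Sum>s<k. A r s * y l s) * cnj (y l t))"
    unfolding sum_distrib_right by (rule sum.swap)
  also have "\<dots> = 0" using Ay by simp
  finally show ?thesis .
qed

section \<open>Passage between matrices and forms\<close>

lemma mult_mat_index_sum:
  assumes "A \<in> carrier_mat k k" "B \<in> carrier_mat k k" "r < k" "t < k"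
  shows "(A * B) $$ (r, t) = (\<Sum>s<k. A $$ (r, s) * B $$ (s, t))"
  using assms by (auto simp: scalar_prod_def atLeast0LessThan intro!: sum.cong)

lemma mat_trace_mult:
  assumes "A \<in> carrier_mat k k" "B \<in> carrier_mat k k"
  shows "mat_trace (A * B) = (\<Sum>r<k. \<Sum>s<k. A $$ (r, s) * B $$ (s, r))"
proof -
  have "mat_trace (A * B) = (\<Sum>r<k. (A * B) $$ (r, r))"
    using assms by (simp add: mat_trace_def)
  then show ?thesis using mult_mat_index_sum[OF assms] by simp
qed

lemma psd_mat_carrier: "psd_mat k A \<Longrightarrow> A \<in> carrier_mat k k"
  by (simp add: psd_mat_def)

lemma psd_mat_index_cnj:
  assumes "psd_mat k A" "r < k" "s < k"
  shows "A $$ (s, r) = cnj (A $$ (r, s))"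
proof -
  have A: "A \<in> carrier_mat k k" "mat_adjoint A = A" using assms by (auto simp: psd_mat_def)
  have "A $$ (s, r) = mat_adjoint A $$ (s, r)" using A by simp
  also have "\<dots> = cnj (A $$ (r, s))"
    using A(1) assms(2,3) unfolding mat_adjoint_def by (subst mat_of_rows_index) auto
  finally show ?thesis .
qed

lemma pos_form_psd_mat:
  assumes "psd_mat k A"
  shows "pos_form k (\<lambda>r s. A $$ (r, s))"
  unfolding pos_form_def
proof (intro conjI allI impI)
  fix x :: "nat \<Rightarrow> complex"
  have A: "A \<in> carrier_mat k k" using assms by (simp add: psd_mat_def)
  have "(A *\<^sub>v vec k x) \<bullet>c vec k x = hform k (\<lambda>r s. A $$ (r, s)) x x"
    using A by (auto simp: scalar_prod_def hform_def atLeast0LessThan sum_distrib_right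
        intro!: sum.cong)
  moreover have "0 \<le> Re ((A *\<^sub>v vec k x) \<bullet>c vec k x)"
    using assms by (simp add: psd_mat_def)
  ultimately show "0 \<le> Re (hform k (\<lambda>r s. A $$ (r, s)) x x)" by simp
qed (rule psd_mat_index_cnj[OF assms])

lemma psd_mat_mult_eq_0:
  assumes A: "psd_mat k A" and B: "psd_mat k B" and tr: "mat_trace (A * B) = 0"
  shows "A * B = 0\<^sub>m k k"
proof (rule eq_matI)
  note carr = psd_mat_carrier[OF A] psd_mat_carrier[OF B]
  fix r t assume "r < dim_row (0\<^sub>m k k :: complex mat)" "t < dim_col (0\<^sub>m k k :: complex mat)"
  then have rt: "r < k" "t < k" by simp_all
  show "(A * B) $$ (r, t) = 0\<^sub>m k k $$ (r, t)"
    using pos_form_product_eq_0[OF pos_form_psd_mat[OF A] pos_form_psd_mat[OF B] _ rt]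
      tr rt by (simp add: mat_trace_mult[OF carr] mult_mat_index_sum[OF carr])
qed (use psd_mat_carrier[OF A] psd_mat_carrier[OF B] in auto)

section \<open>Cancellation in products with positive semidefinite matrices\<close>

lemma mat_eq_0_if_rows_norm_0:
  fixes C :: "complex mat"
  assumes C: "C \<in> carrier_mat m n"
    and rows: "\<And>r. r < m \<Longrightarrow> (\<Sum>s<n. C $$ (r, s) * cnj (C $$ (r, s))) = 0"
  shows "C = 0\<^sub>m m n"
proof (rule eq_matI)
  fix r s assume "r < dim_row (0\<^sub>m m n :: complex mat)" "s < dim_col (0\<^sub>m m n :: complex mat)"
  then have rs: "r < m" "s < n" by simp_all
  have "(\<Sum>s<n. complex_of_real ((cmod (C $$ (r, s)))\<^sup>2)) = 0"
    using rows[OF rs(1)] by (simp only: complex_norm_square)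
  then have "(\<Sum>s<n. (cmod (C $$ (r, s)))\<^sup>2) = 0"
    by (metis of_real_eq_0_iff of_real_sum)
  then show "C $$ (r, s) = 0\<^sub>m m n $$ (r, s)"
    using rs by (subst (asm) sum_nonneg_eq_0_iff) auto
qed (use C in auto)

text \<open>As \<open>B\<close> is Hermitian, \<open>C * B\<close> times its adjoint is
  \<open>C * B * B\<close> times the adjoint of \<open>C\<close>, hence zero; its diagonal holds the
  squared row norms of \<open>C * B\<close>.\<close>

lemma psd_mat_cancel_square:
  assumes B: "psd_mat k B" and C: "C \<in> carrier_mat k k" and CBB: "C * B * B = 0\<^sub>m k k"
  shows "C * B = 0\<^sub>m k k"
proof (rule mat_eq_0_if_rows_norm_0)
  note Bc = psd_mat_carrier[OF B]
  show CB: "C * B \<in> carrier_mat k k" using Bc C by simp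
  fix r assume r: "r < k"
  have cnjCB: "cnj ((C * B) $$ (r, s)) = (\<Sum>t<k. cnj (C $$ (r, t)) * B $$ (s, t))" if "s < k" for s
    unfolding mult_mat_index_sum[OF C Bc r that] cnj_sum
    using that psd_mat_index_cnj[OF B, of _ s] by (intro sum.cong refl) auto
  have "(\<Sum>s<k. (C * B) $$ (r, s) * cnj ((C * B) $$ (r, s)))
      = (\<Sum>s<k. \<Sum>t<k. cnj (C $$ (r, t)) * ((C * B) $$ (r, s) * B $$ (s, t)))"
    by (intro sum.cong refl) (simp add: cnjCB sum_distrib_left mult_ac del: index_mult_mat)
  also have "\<dots> = (\<Sum>t<k. cnj (C $$ (r, t)) * (\<Sum>s<k. (C * B) $$ (r, s) * B $$ (s, t)))"
    unfolding sum_distrib_left by (rule sum.swap)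
  also have "\<dots> = (\<Sum>t<k. cnj (C $$ (r, t)) * (C * B * B) $$ (r, t))"
    using mult_mat_index_sum[OF CB Bc r] by (intro sum.cong refl) simp
  also have "\<dots> = 0" using r unfolding CBB by simp
  finally show "(\<Sum>s<k. (C * B) $$ (r, s) * cnj ((C * B) $$ (r, s))) = 0" .
qed

lemma psd_mat_proportional:
  assumes P: "psd_mat k P" and Q: "psd_mat k Q"
    and a: "Q * P = a \<cdot>\<^sub>m (P * P)" and b: "Q * P = b \<cdot>\<^sub>m (Q * Q)" "b \<noteq> 0"
  shows "Q = a \<cdot>\<^sub>m P"
proof -
  note Pc = psd_mat_carrier[OF P] and Qc = psd_mat_carrier[OF Q]
  define X where "X = Q - a \<cdot>\<^sub>m P"
  have X: "X \<in> carrier_mat k k" unfolding X_def by (intro minus_carrier_mat smult_carrier_mat Pc)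
  have "X * P = Q * P - a \<cdot>\<^sub>m P * P"
    unfolding X_def using Pc Qc by (intro minus_mult_distrib_mat) auto
  also have "a \<cdot>\<^sub>m P * P = a \<cdot>\<^sub>m (P * P)"
    by (rule mult_smult_assoc_mat[OF Pc Pc])
  finally have XP: "X * P = 0\<^sub>m k k"
    unfolding a using Pc by simp
  \<comment> \<open>Both hypotheses describe \<open>Q * P\<close>, so the square of \<open>Q\<close>
    can be traded for that of \<open>P\<close>, which \<open>X\<close> annihilates.\<close>
  have "b \<cdot>\<^sub>m (X * (Q * Q)) = X * (b \<cdot>\<^sub>m (Q * Q))"
    using mult_smult_distrib[OF X, of "Q * Q" k b] Qc by simp
  also have "\<dots> = X * (a \<cdot>\<^sub>m (P * P))"
    using a b(1) by simp
  also have "\<dots> = a \<cdot>\<^sub>m (X * (P * P))"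
    using mult_smult_distrib[OF X, of "P * P" k a] Pc by simp
  also have "X * (P * P) = 0\<^sub>m k k"
    using XP Pc by (simp flip: assoc_mult_mat[OF X Pc Pc])
  finally have bXQQ: "b \<cdot>\<^sub>m (X * Q * Q) = 0\<^sub>m k k"
    unfolding assoc_mult_mat[OF X Qc Qc] by simp
  have XQQ: "X * Q * Q \<in> carrier_mat k k" using X Qc by simp
  have "X * Q * Q = 0\<^sub>m k k"
  proof (rule eq_matI)
    fix r s assume "r < dim_row (0\<^sub>m k k :: complex mat)" "s < dim_col (0\<^sub>m k k :: complex mat)"
    then have rs: "r < k" "s < k" by simp_all
    have "(b \<cdot>\<^sub>m (X * Q * Q)) $$ (r, s) = b * (X * Q * Q) $$ (r, s)"
      by (rule index_smult_mat(1)) (use XQQ rs in auto)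
    then show "(X * Q * Q) $$ (r, s) = 0\<^sub>m k k $$ (r, s)"
      using b(2) rs unfolding bXQQ by simp
  qed (use XQQ in auto)
  then have XQ: "X * Q = 0\<^sub>m k k"
    by (rule psd_mat_cancel_square[OF Q X])
  \<comment> \<open>The adjoint of \<open>X\<close> is \<open>Q\<close> minus \<open>cnj a\<close>
    times \<open>P\<close>, so \<open>X\<close> times its adjoint is a combination of
    \<open>X * Q\<close> and \<open>X * P\<close>.\<close>
  have "X = 0\<^sub>m k k"
  proof (rule mat_eq_0_if_rows_norm_0[OF X])
    fix r assume r: "r < k"
    have "(\<Sum>s<k. X $$ (r, s) * cnj (X $$ (r, s)))
        = (\<Sum>s<k. X $$ (r, s) * Q $$ (s, r) - cnj a * (X $$ (r, s) * P $$ (s, r)))"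
    proof (intro sum.cong refl)
      fix s assume "s \<in> {..<k}"
      then have s: "s < k" by simp
      have cnjX: "cnj (X $$ (r, s)) = Q $$ (s, r) - cnj a * P $$ (s, r)"
        unfolding psd_mat_index_cnj[OF P r s] psd_mat_index_cnj[OF Q r s]
        using r s Pc Qc by (simp add: X_def)
      show "X $$ (r, s) * cnj (X $$ (r, s))
          = X $$ (r, s) * Q $$ (s, r) - cnj a * (X $$ (r, s) * P $$ (s, r))"
        unfolding cnjX by (simp add: algebra_simps)
    qed
    also have "\<dots> = (X * Q) $$ (r, r) - cnj a * (X * P) $$ (r, r)"
      unfolding mult_mat_index_sum[OF X Qc r r] mult_mat_index_sum[OF X Pc r r]
      by (simp add: sum_subtractf sum_distrib_left)
    also have "\<dots> = 0" unfolding XQ XP using r by simp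
    finally show "(\<Sum>s<k. X $$ (r, s) * cnj (X $$ (r, s))) = 0" .
  qed
  show ?thesis
  proof (rule eq_matI)
    fix r s assume "r < dim_row (a \<cdot>\<^sub>m P)" "s < dim_col (a \<cdot>\<^sub>m P)"
    then have rs: "r < k" "s < k" using Pc by auto
    have "X $$ (r, s) = 0" using \<open>X = 0\<^sub>m k k\<close> rs by simp
    then show "Q $$ (r, s) = (a \<cdot>\<^sub>m P) $$ (r, s)"
      using rs Pc Qc by (simp add: X_def)
  qed (use Pc Qc in auto)
qed

section \<open>Transfer of linear relations along equal Gram matrices\<close>

lemma sum_norm_combination:
  fixes f :: "nat \<Rightarrow> 'a \<Rightarrow> complex"
  shows "(\<Sum>l\<in>L. (\<Sum>i\<in>T. c i * f i l) * cnj (\<Sum>i\<in>T. c i * f i l))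
    = (\<Sum>i\<in>T. \<Sum>j\<in>T. c i * cnj (c j) * (\<Sum>l\<in>L. f i l * cnj (f j l)))"
proof -
  have "(\<Sum>l\<in>L. (\<Sum>i\<in>T. c i * f i l) * cnj (\<Sum>i\<in>T. c i * f i l))
      = (\<Sum>l\<in>L. \<Sum>i\<in>T. \<Sum>j\<in>T. c i * cnj (c j) * (f i l * cnj (f j l)))"
    unfolding cnj_sum sum_product by (simp add: mult_ac)
  also have "\<dots> = (\<Sum>i\<in>T. \<Sum>l\<in>L. \<Sum>j\<in>T. c i * cnj (c j) * (f i l * cnj (f j l)))"
    by (rule sum.swap)
  also have "\<dots> = (\<Sum>i\<in>T. \<Sum>j\<in>T. c i * cnj (c j) * (\<Sum>l\<in>L. f i l * cnj (f j l)))"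
    unfolding sum_distrib_left by (intro sum.cong refl sum.swap)
  finally show ?thesis .
qed

text \<open>The squared norm of a combination depends only on the Gram matrix, so a vanishing
  combination in one family vanishes in the other. The index types differ because the lemma links
  vectors and matrices, in both directions.\<close>

lemma combination_eq_0_transfer:
  fixes f :: "nat \<Rightarrow> 'a \<Rightarrow> complex" and g :: "nat \<Rightarrow> 'b \<Rightarrow> complex"
  assumes gram: "\<And>i j. i \<in> T \<Longrightarrow> j \<in> T \<Longrightarrow>
      (\<Sum>l\<in>L. f i l * cnj (f j l)) = (\<Sum>l\<in>M. g i l * cnj (g j l))"
    and f: "\<And>l. l \<in> L \<Longrightarrow> (\<Sum>i\<in>T. c i * f i l) = 0"
    and M: "finite M" "l \<in> M"
  shows "(\<Sum>i\<in>T. c i * g i l) = 0"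
proof -
  have "(\<Sum>l\<in>M. (\<Sum>i\<in>T. c i * g i l) * cnj (\<Sum>i\<in>T. c i * g i l))
      = (\<Sum>l\<in>L. (\<Sum>i\<in>T. c i * f i l) * cnj (\<Sum>i\<in>T. c i * f i l))"
    unfolding sum_norm_combination by (intro sum.cong refl) (simp add: gram)
  also have "\<dots> = 0" using f by simp
  finally have "(\<Sum>l\<in>M. complex_of_real ((cmod (\<Sum>i\<in>T. c i * g i l))\<^sup>2)) = 0"
    by (simp only: complex_norm_square)
  then have "(\<Sum>l\<in>M. (cmod (\<Sum>i\<in>T. c i * g i l))\<^sup>2) = 0"
    by (simp only: of_real_eq_0_iff flip: of_real_sum)
  then show ?thesis
    using M by (subst (asm) sum_nonneg_eq_0_iff) auto
qed

text \<open>For Hermitian \<open>B\<close> the trace is the Frobenius inner product, so the matrices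
  become vectors indexed by pairs with the same Gram matrix as the \<open>u i\<close>.\<close>

lemma psd_mat_trace_mult:
  assumes "psd_mat k A" "psd_mat k B"
  shows "mat_trace (A * B) = (\<Sum>p\<in>{..<k} \<times> {..<k}. A $$ p * cnj (B $$ p))"
proof -
  have "mat_trace (A * B) = (\<Sum>r<k. \<Sum>s<k. A $$ (r, s) * cnj (B $$ (r, s)))"
    unfolding mat_trace_mult[OF psd_mat_carrier psd_mat_carrier, OF assms]
    by (intro sum.cong refl) (simp add: psd_mat_index_cnj[OF assms(2), symmetric])
  then show ?thesis by (simp add: sum.cartesian_product)
qed

section \<open>Matrices realising the Gram matrix\<close>

locale minimal_upb_psd_gram =
  fixes d k :: nat and u v :: "nat \<Rightarrow> complex vec" and P :: "nat \<Rightarrow> complex mat"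
  assumes d: "d \<ge> 2"
    and upb: "unextendible_product_basis d d (2 * d - 1) u v"
    and psd: "\<And>i. i < 2 * d - 1 \<Longrightarrow> psd_mat k (P i)"
    and gram: "\<And>i j. i < 2 * d - 1 \<Longrightarrow> j < 2 * d - 1 \<Longrightarrow> u i \<bullet>c u j = mat_trace (P i * P j)"
begin

abbreviation n where "n \<equiv> 2 * d - 1"

definition orth :: "nat \<Rightarrow> nat set" where "orth i = {j. j < n \<and> u i \<bullet>c u j = 0}"

lemmas u = upb_carrier(1,2)[OF upb]
lemmas P = psd_mat_carrier[OF psd]

lemma card_orth: "i < n \<Longrightarrow> card (orth i) = d - 1"
  unfolding orth_def by (rule upb_minimal_card_orthogonal[OF upb])

lemma finite_orth: "finite (orth i)"
  by (simp add: orth_def)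

lemma not_self_orth: "i < n \<Longrightarrow> i \<notin> orth i"
  using u cscalar_prod_self_eq_0[of "u i" d] by (simp add: orth_def)

lemma spanning:
  assumes "S \<subseteq> {..<n}" "card S = d" "x \<in> carrier_vec d" "\<And>i. i \<in> S \<Longrightarrow> x \<bullet>c u i = 0"
  shows "x = 0\<^sub>v d"
  using upb_minimal_spanning_left[OF upb assms(1) _ assms(3,4)] assms(2) d by simp

lemma gram_sum:
  assumes "i < n" "j < n"
  shows "(\<Sum>l<d. u i $ l * cnj (u j $ l)) = (\<Sum>p\<in>{..<k} \<times> {..<k}. P i $$ p * cnj (P j $$ p))"
  using gram[OF assms] psd_mat_trace_mult[OF psd psd, OF assms]
    cscalar_prod_eq_sum[OF u(1) u(1), OF assms] by simp

lemma P_orth: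
  assumes i: "i < n" and "j \<in> orth i"
  shows "P i * P j = 0\<^sub>m k k" "P j * P i = 0\<^sub>m k k"
proof -
  have j: "j < n" and uij: "u i \<bullet>c u j = 0" using assms(2) by (auto simp: orth_def)
  have uji: "u j \<bullet>c u i = 0"
    using cscalar_prod_commute_cnj[OF u(1)[OF i] u(1)[OF j]] uij by simp
  show "P i * P j = 0\<^sub>m k k" "P j * P i = 0\<^sub>m k k"
    using psd_mat_mult_eq_0[OF psd[OF i] psd[OF j]] psd_mat_mult_eq_0[OF psd[OF j] psd[OF i]]
      gram[OF i j] gram[OF j i] uij uji by auto
qed

text \<open>The vectors \<open>u i\<close> and \<open>u j\<close>, \<open>j \<in> orth i\<close>, span the space; multiplying the corresponding
  expansion of \<open>P m\<close> by \<open>P i\<close> kills every term but the one of index \<open>i\<close>.\<close>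

lemma P_mult_eq_square:
  assumes i: "i < n" and m: "m < n" and "m \<noteq> i" "m \<notin> orth i"
  obtains a where "P m * P i = a \<cdot>\<^sub>m (P i * P i)" "P i * P m = a \<cdot>\<^sub>m (P i * P i)"
proof -
  define S where "S = insert i (orth i)"
  have S: "finite S" "S \<subseteq> {..<n}" "m \<notin> S" "i \<in> S"
    using assms by (auto simp: S_def finite_orth) (auto simp: orth_def)
  have card: "card S = d"
    using card_orth[OF i] not_self_orth[OF i] d by (simp add: S_def finite_orth)
  obtain a where a: "\<And>l. l < d \<Longrightarrow> u m $ l = (\<Sum>j\<in>S. a j * u j $ l)"
    using ex_linear_combination[OF S(1) card _ spanning[OF S(2) card] u(1)[OF m]] u(1) S(2)
    by blast
  have comb: "P m $$ p = (\<Sum>j\<in>S. a j * P j $$ p)" if p: "p \<in> {..<k} \<times> {..<k}" for p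
  proof -
    \<comment> \<open>The coefficient -1 at \<open>m\<close> makes the expansion of
      \<open>u m\<close> a homogeneous relation, ready for the transfer to the
      \<open>P j\<close>.\<close>
    define c where "c = a(m := -1)"
    have sum_c: "(\<Sum>j\<in>insert m S. c j * h j) = (\<Sum>j\<in>S. a j * h j) - h m" for h :: "nat \<Rightarrow> complex"
    proof -
      have "(\<Sum>j\<in>S. c j * h j) = (\<Sum>j\<in>S. a j * h j)"
        using S(3) by (intro sum.cong refl) (auto simp: c_def)
      then show ?thesis using S(1,3) by (simp add: c_def)
    qed
    have "(\<Sum>j\<in>insert m S. c j * P j $$ p) = 0"
    proof (rule combination_eq_0_transfer[where f = "\<lambda>j l. u j $ l" and L = "{..<d}"])
      show "(\<Sum>l<d. u i' $ l * cnj (u j $ l)) = (\<Sum>p\<in>{..<k} \<times> {..<k}. P i' $$ p * cnj (P j $$ p))"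
        if "i' \<in> insert m S" "j \<in> insert m S" for i' j
        using gram_sum that S(2) m by blast
      show "(\<Sum>j\<in>insert m S. c j * u j $ l) = 0" if "l \<in> {..<d}" for l
        using a[of l] that unfolding sum_c by simp
    qed (use p in auto)
    then show ?thesis unfolding sum_c by simp
  qed
  have single: "(\<Sum>j\<in>S. a j * h j) = a i * h i" if "\<And>j. j \<in> orth i \<Longrightarrow> h j = 0" for h :: "nat \<Rightarrow> complex"
    using that not_self_orth[OF i] by (simp add: S_def finite_orth)
  have PS: "P j \<in> carrier_mat k k" if "j \<in> S" for j
    using P S(2) that by blast
  note Pi = P[OF i] and Pm = P[OF m]
  have "P m * P i = a i \<cdot>\<^sub>m (P i * P i)"
  proof (rule eq_matI)
    fix r s assume "r < dim_row (a i \<cdot>\<^sub>m (P i * P i))" "s < dim_col (a i \<cdot>\<^sub>m (P i * P i))"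
    then have rs: "r < k" "s < k" using Pi by auto
    have "(P m * P i) $$ (r, s) = (\<Sum>t<k. \<Sum>j\<in>S. a j * (P j $$ (r, t) * P i $$ (t, s)))"
      unfolding mult_mat_index_sum[OF Pm Pi rs]
      using rs by (intro sum.cong refl) (simp add: comb sum_distrib_right mult.assoc)
    also have "\<dots> = (\<Sum>j\<in>S. a j * (\<Sum>t<k. P j $$ (r, t) * P i $$ (t, s)))"
      unfolding sum_distrib_left by (rule sum.swap)
    also have "\<dots> = (\<Sum>j\<in>S. a j * (P j * P i) $$ (r, s))"
      using mult_mat_index_sum[OF PS Pi rs] by (intro sum.cong refl) simp
    also have "\<dots> = a i * (P i * P i) $$ (r, s)"
      by (rule single) (use P_orth(2)[OF i] rs in simp)
    finally show "(P m * P i) $$ (r, s) = (a i \<cdot>\<^sub>m (P i * P i)) $$ (r, s)"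
      using rs Pi by simp
  qed (use Pi Pm in auto)
  \<comment> \<open>The coefficient is again \<open>a i\<close>, so \<open>P i\<close> and
    \<open>P m\<close> commute.\<close>
  moreover have "P i * P m = a i \<cdot>\<^sub>m (P i * P i)"
  proof (rule eq_matI)
    fix r s assume "r < dim_row (a i \<cdot>\<^sub>m (P i * P i))" "s < dim_col (a i \<cdot>\<^sub>m (P i * P i))"
    then have rs: "r < k" "s < k" using Pi by auto
    have "(P i * P m) $$ (r, s) = (\<Sum>t<k. \<Sum>j\<in>S. a j * (P i $$ (r, t) * P j $$ (t, s)))"
      unfolding mult_mat_index_sum[OF Pi Pm rs]
      using rs by (intro sum.cong refl) (simp add: comb sum_distrib_left mult_ac)
    also have "\<dots> = (\<Sum>j\<in>S. a j * (\<Sum>t<k. P i $$ (r, t) * P j $$ (t, s)))"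
      unfolding sum_distrib_left by (rule sum.swap)
    also have "\<dots> = (\<Sum>j\<in>S. a j * (P i * P j) $$ (r, s))"
      using mult_mat_index_sum[OF Pi PS rs] by (intro sum.cong refl) simp
    also have "\<dots> = a i * (P i * P i) $$ (r, s)"
      by (rule single) (use P_orth(1)[OF i] rs in simp)
    finally show "(P i * P m) $$ (r, s) = (a i \<cdot>\<^sub>m (P i * P i)) $$ (r, s)"
      using rs Pi by simp
  qed (use Pi Pm in auto)
  ultimately show thesis by (rule that)
qed

lemma contradiction: False
proof -
  define i where "i = (0 :: nat)"
  have i: "i < n" using d by (simp add: i_def)
  \<comment> \<open>The left side is \<open>d\<close>, which is below \<open>2 * d - 1\<close>
    because \<open>d \<ge> 2\<close>; so some index \<open>m\<close> remains.\<close>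
  have "card (insert i (orth i)) < card {..<n}"
    using card_orth[OF i] not_self_orth[OF i] d by (simp add: finite_orth)
  then obtain m where m: "m < n" "m \<noteq> i" "m \<notin> orth i"
    using card_mono[of "insert i (orth i)" "{..<n}"] finite_orth[of i] by fastforce
  have i_orth: "i \<notin> orth m"
    using m i cscalar_prod_commute_cnj[OF u(1)[OF m(1)] u(1)[OF i]] by (auto simp: orth_def)
  obtain a where a: "P m * P i = a \<cdot>\<^sub>m (P i * P i)"
    using P_mult_eq_square[OF i m] by blast
  \<comment> \<open>The same lemma with \<open>i\<close> and \<open>m\<close> exchanged; its second
    equation again concerns \<open>P m * P i\<close>.\<close>
  obtain b where b: "P m * P i = b \<cdot>\<^sub>m (P m * P m)"
    using P_mult_eq_square[OF m(1) i m(2)[symmetric] i_orth] by blast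
  have "b \<noteq> 0"
  proof
    assume "b = 0"
    then have "P m * P i = 0\<^sub>m k k"
      using b P[OF m(1)] by auto
    then have "u m \<bullet>c u i = 0"
      using gram[OF m(1) i] by (simp add: mat_trace_def)
    then show False using i_orth i by (simp add: orth_def)
  qed
  then have Pm: "P m = a \<cdot>\<^sub>m P i"
    using psd_mat_proportional[OF psd[OF i] psd[OF m(1)] a b] by blast
  \<comment> \<open>The relation between \<open>P m\<close> and \<open>P i\<close> is carried back
    to \<open>u m\<close> and \<open>u i\<close>.\<close>
  define c where "c = (\<lambda>j. if j = m then 1 else - a)"
  have um: "u m $ l = a * u i $ l" if l: "l < d" for l
  proof -
    have "(\<Sum>j\<in>{i, m}. c j * u j $ l) = 0"
    proof (rule combination_eq_0_transfer[where f = "\<lambda>j p. P j $$ p"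
          and L = "{..<k} \<times> {..<k}" and M = "{..<d}"])
      show "(\<Sum>p\<in>{..<k} \<times> {..<k}. P i' $$ p * cnj (P j $$ p)) = (\<Sum>l<d. u i' $ l * cnj (u j $ l))"
        if "i' \<in> {i, m}" "j \<in> {i, m}" for i' j
        using gram_sum[of i' j] that i m(1) by auto
      show "(\<Sum>j\<in>{i, m}. c j * P j $$ p) = 0" if "p \<in> {..<k} \<times> {..<k}" for p
        using that m(2) P[OF i] by (auto simp: c_def Pm)
    qed (use l in auto)
    then show ?thesis using m(2) by (simp add: c_def)
  qed
  have "orth i \<noteq> {}"
    using card_orth[OF i] d by (intro notI) simp
  then obtain j where j: "j \<in> orth i" by blast
  \<comment> \<open>Dropping \<open>j\<close> makes room for \<open>m\<close>:
    \<open>insert m R\<close> has \<open>d\<close> elements and must span, but \<open>u m\<close> is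
    a multiple of \<open>u i\<close>, so any vector orthogonal to the \<open>d - 1\<close> vectors
    of \<open>R\<close> is orthogonal to all of them.\<close>
  define R where "R = insert i (orth i - {j})"
  have R: "finite R" "R \<subseteq> {..<n}" "m \<notin> R" "i \<in> R"
    using i m by (auto simp: R_def finite_orth) (auto simp: orth_def)
  have card_R: "card R = d - 1"
    using card_orth[OF i] not_self_orth[OF i] j d by (simp add: R_def finite_orth)
  obtain x where x: "x \<in> carrier_vec d" "x \<noteq> 0\<^sub>v d" "\<And>i. i \<in> R \<Longrightarrow> x \<bullet>c u i = 0"
    using ex_common_orthogonal[OF R(1), of d u] card_R d u(1) R(2) by auto
  have "x \<bullet>c u m = cnj a * (x \<bullet>c u i)"
    unfolding cscalar_prod_eq_sum[OF x(1) u(1)[OF i]] cscalar_prod_eq_sum[OF x(1) u(1)[OF m(1)]]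
      sum_distrib_left by (intro sum.cong refl) (simp add: um)
  then have "x \<bullet>c u m = 0" using x(3) R(4) by simp
  then have "x = 0\<^sub>v d"
    using x R m(1) card_R d by (intro spanning[of "insert m R"]) auto
  then show False using x(2) by simp
qed

end

theorem theorem6p12:
  fixes d :: nat and u :: "nat \<Rightarrow> complex vec"
  assumes "d \<ge> 2"
    and "\<exists>v. unextendible_product_basis d d (2 * d - 1) u v"
  shows "\<not> completely_psd (2 * d - 1) (gram_matrix (2 * d - 1) u)"
proof
  assume "completely_psd (2 * d - 1) (gram_matrix (2 * d - 1) u)"
  then obtain k P where P: "\<And>i. i < 2 * d - 1 \<Longrightarrow> psd_mat k (P i)"
    and X: "\<And>i j. i < 2 * d - 1 \<Longrightarrow> j < 2 * d - 1 \<Longrightarrow>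
      gram_matrix (2 * d - 1) u $$ (i, j) = mat_trace (P i * P j)"
    unfolding completely_psd_def by blast
  obtain v where v: "unextendible_product_basis d d (2 * d - 1) u v"
    using assms(2) by blast
  have "minimal_upb_psd_gram d k u v P"
    using assms(1) v P X by unfold_locales (simp_all add: gram_matrix_def)
  then show False by (rule minimal_upb_psd_gram.contradiction)
qed

end
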